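(* Let $(g,d,f,\xi)$ be an optimal solution of the SC-ST clearing problem and let $(\pi,\overline{\lambda})$ be an optimal solution of its dual problem. Then the prices $\pi$ and allocations $(g,d,f,\xi)$ represent a competitive equilibrium.
   Context: Setting (space-time supply chain, SC-ST). $\mathcal{N}$ is a finite set of spatial nodes, $\mathcal{T}$ a finite ordered set of times, $\mathcal{S}=\mathcal{N}\times\mathcal{T}$ the set of space-time nodes $s=(n,t)$, $\mathcal{P}$ a finite set of products. There are finite sets of stakeholders (players): suppliers $\mathcal{G}$, consumers $\mathcal{D}$, transport providers $\mathcal{L}$, technology providers $\mathcal{M}$. - Supplier $i$: node $s(i)\in\mathcal{S}$, product $p(i)\in\mathcal{P}$, flow $g_i\ge0$, capacity $\overline{g}_i\ge0$, bid $\alpha^g_i\in\mathbb{R}$. - Consumer $j$: node $s(j)\in\mathcal{S}$, product $p(j)\in\mathcal{P}$, flow $d_j\ge0$, capacity $\overline{d}_j\ge0$, bid $\alpha^d_j\in\mathbb{R}$. - Transport provider $l$: base node $s_b(l)\in\mathcal{S}$, receiving node $s_r(l)\in\mathcal{S}$, product $p(l)\in\mathcal{P}$, flow $f_l\ge0$, capacity $\overline{f}_l\ge0$, bid $\alpha^f_l\ge0$. - Technology provider $m$: node $s(m)\in\mathcal{S}$, sets $\mathcal{P}^{con}_m,\mathcal{P}^{gen}_m\subset\mathcal{P}$ of consumed and generated products, yields $\gamma_{m,p}\ge0$ with $\gamma_{m,\bar p_m}=1$ for a reference product $\bar p_m\in\mathcal{P}^{con}_m$, flow $\xi_m\ge0$,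 capacity $\overline{\xi}_m\ge0$, bid $\alpha^\xi_m\ge0$. For $(s,p)\in\mathcal{S}\times\mathcal{P}$: $\mathcal{G}_{s,p}=\{i:s(i)=s,p(i)=p\}$, $\mathcal{D}_{s,p}=\{j:s(j)=s,p(j)=p\}$, $\mathcal{L}^{in}_{s,p}=\{l:s_r(l)=s,p(l)=p\}$, $\mathcal{L}^{out}_{s,p}=\{l:s_b(l)=s,p(l)=p\}$, $\mathcal{M}^{con}_{s,p}=\{m:s(m)=s,p\in\mathcal{P}^{con}_m\}$, $\mathcal{M}^{gen}_{s,p}=\{m:s(m)=s,p\in\mathcal{P}^{gen}_m\}$. SC-ST clearing problem (primal): maximize $\sum_j\alpha^d_jd_j-\sum_i\alpha^g_ig_i-\sum_l\alpha^f_lf_l-\sum_m\alpha^\xi_m\xi_m$ over nonnegative $(g,d,f,\xi)$ subject to the clearing constraints, for all $(s,p)\in\mathcal{S}\times\mathcal{P}$ (dual variable $\pi_{s,p}\in\mathbb{R}$, the clearing price), $$\sum_{i\in\mathcal{G}_{s,p}}g_i+\sum_{l\in\mathcal{L}^{in}_{s,p}}f_l+\sum_{m\in\mathcal{M}^{gen}_{s,p}}\gamma_{m,p}\xi_m=\sum_{j\in\mathcal{D}_{s,p}}d_j+\sum_{l\in\mathcal{L}^{out}_{s,p}}f_l+\sum_{m\in\mathcal{M}^{con}_{s,p}}\gamma_{m,p}\xi_m,$$ and capacity constraints $g_i\le\overline{g}_i$, $d_j\le\overline{d}_j$, $f_l\le\overline{f}_l$, $\xi_m\le\overline{\xi}_m$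 (dual variables $\overline{\lambda}_i,\overline{\lambda}_j,\overline{\lambda}_l,\overline{\lambda}_m\ge0$). Stakeholder prices: $\pi_i=\pi_{s(i),p(i)}$, $\pi_j=\pi_{s(j),p(j)}$, $\pi_l=\pi_{s_r(l),p(l)}-\pi_{s_b(l),p(l)}$, $\pi_m=\sum_{p\in\mathcal{P}^{gen}_m}\gamma_{m,p}\pi_{s(m),p}-\sum_{p\in\mathcal{P}^{con}_m}\gamma_{m,p}\pi_{s(m),p}$. Dual problem: minimize $\sum_i\overline{g}_i\overline{\lambda}_i+\sum_j\overline{d}_j\overline{\lambda}_j+\sum_l\overline{f}_l\overline{\lambda}_l+\sum_m\overline{\xi}_m\overline{\lambda}_m$ over $\pi$ (free) and $\overline{\lambda}\ge0$ subject to $\pi_i-\overline{\lambda}_i\le\alpha^g_i$, $\pi_j+\overline{\lambda}_j\ge\alpha^d_j$, $\pi_l-\overline{\lambda}_l\le\alpha^f_l$, $\pi_m-\overline{\lambda}_m\le\alpha^\xi_m$ for all players. Profits: $\phi^g_i=(\pi_i-\alpha^g_i)g_i$, $\phi^d_j=(\alpha^d_j-\pi_j)d_j$, $\phi^f_l=(\pi_l-\alpha^f_l)f_l$, $\phi^\xi_m=(\pi_m-\alpha^\xi_m)\xi_m$. Competitive equilibrium: prices $\pi$ and allocations $(g,d,f,\xi)$ such that (1) at the fixed prices $\pi$, each player's allocation independently maximizes that player's own profit over its range between $0$ and its capacity, and (2) the allocations satisfy all the clearing constraints. *)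

theory Defs
  imports "HOL-Analysis.Analysis"
begin

type_synonym ('n, 't) st_node = "'n \<times> 't"

(* Finite carrier sets live inside arbitrary types; all data are total functions of which
   only the values on the carriers matter. *)
record ('n, 't, 'p, 'g, 'd, 'l, 'm) supply_chain =
  spatial_nodes :: "'n set"
  times :: "'t set"
  products :: "'p set"
  suppliers :: "'g set"
  consumers :: "'d set"
  transports :: "'l set"
  technologies :: "'m set"
  sup_node :: "'g \<Rightarrow> ('n, 't) st_node"
  sup_prod :: "'g \<Rightarrow> 'p"
  sup_cap :: "'g \<Rightarrow> real"
  sup_bid :: "'g \<Rightarrow> real"
  con_node :: "'d \<Rightarrow> ('n, 't) st_node"
  con_prod :: "'d \<Rightarrow> 'p"
  con_cap :: "'d \<Rightarrow> real"
  con_bid :: "'d \<Rightarrow> real"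
  tra_base :: "'l \<Rightarrow> ('n, 't) st_node"
  tra_recv :: "'l \<Rightarrow> ('n, 't) st_node"
  tra_prod :: "'l \<Rightarrow> 'p"
  tra_cap :: "'l \<Rightarrow> real"
  tra_bid :: "'l \<Rightarrow> real"
  tec_node :: "'m \<Rightarrow> ('n, 't) st_node"
  tec_con :: "'m \<Rightarrow> 'p set"
  tec_gen :: "'m \<Rightarrow> 'p set"
  tec_ref :: "'m \<Rightarrow> 'p"
  tec_yield :: "'m \<Rightarrow> 'p \<Rightarrow> real"
  tec_cap :: "'m \<Rightarrow> real"
  tec_bid :: "'m \<Rightarrow> real"

definition st_nodes :: "('n, 't, 'p, 'g, 'd, 'l, 'm) supply_chain \<Rightarrow> ('n, 't) st_node set" where
  "st_nodes C = spatial_nodes C \<times> times C"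

locale sc_st =
  fixes C :: "('n, 't :: linorder, 'p, 'g, 'd, 'l, 'm) supply_chain"
  assumes finite_spatial_nodes: "finite (spatial_nodes C)"
    and finite_times: "finite (times C)"
    and finite_products: "finite (products C)"
    and finite_suppliers: "finite (suppliers C)"
    and finite_consumers: "finite (consumers C)"
    and finite_transports: "finite (transports C)"
    and finite_technologies: "finite (technologies C)"
    and supplier:
      "\<And>i. i \<in> suppliers C \<Longrightarrow>
        sup_node C i \<in> st_nodes C \<and> sup_prod C i \<in> products C \<and> 0 \<le> sup_cap C i"
    and consumer:
      "\<And>j. j \<in> consumers C \<Longrightarrow>
        con_node C j \<in> st_nodes C \<and> con_prod C j \<in> products C \<and> 0 \<le> con_cap C j"
    and transport:
      "\<And>l. l \<in> transports C \<Longrightarrow>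
        tra_base C l \<in> st_nodes C \<and> tra_recv C l \<in> st_nodes C \<and> tra_prod C l \<in> products C \<and>
        0 \<le> tra_cap C l \<and> 0 \<le> tra_bid C l"
    and technology:
      "\<And>m. m \<in> technologies C \<Longrightarrow>
        tec_node C m \<in> st_nodes C \<and> tec_con C m \<subseteq> products C \<and> tec_gen C m \<subseteq> products C \<and>
        (\<forall>p \<in> tec_con C m \<union> tec_gen C m. 0 \<le> tec_yield C m p) \<and>
        tec_ref C m \<in> tec_con C m \<and> tec_yield C m (tec_ref C m) = 1 \<and>
        0 \<le> tec_cap C m \<and> 0 \<le> tec_bid C m"

definition suppliers_at where
  "suppliers_at C s p = {i \<in> suppliers C. sup_node C i = s \<and> sup_prod C i = p}"

definition consumers_at where
  "consumers_at C s p = {j \<in> consumers C. con_node C j = s \<and> con_prod C j = p}"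

definition transports_in where
  "transports_in C s p = {l \<in> transports C. tra_recv C l = s \<and> tra_prod C l = p}"

definition transports_out where
  "transports_out C s p = {l \<in> transports C. tra_base C l = s \<and> tra_prod C l = p}"

definition technologies_con where
  "technologies_con C s p = {m \<in> technologies C. tec_node C m = s \<and> p \<in> tec_con C m}"

definition technologies_gen where
  "technologies_gen C s p = {m \<in> technologies C. tec_node C m = s \<and> p \<in> tec_gen C m}"

type_synonym ('g, 'd, 'l, 'm) allocation =
  "('g \<Rightarrow> real) \<times> ('d \<Rightarrow> real) \<times> ('l \<Rightarrow> real) \<times> ('m \<Rightarrow> real)"

type_synonym ('n, 't, 'p) prices = "('n, 't) st_node \<Rightarrow> 'p \<Rightarrow> real"

definition clearing ::
  "('n, 't, 'p, 'g, 'd, 'l, 'm) supply_chain \<Rightarrow> ('g, 'd, 'l, 'm) allocation \<Rightarrow> bool" where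
  "clearing C = (\<lambda>(g, d, f, \<xi>). \<forall>s \<in> st_nodes C. \<forall>p \<in> products C.
     (\<Sum>i \<in> suppliers_at C s p. g i) + (\<Sum>l \<in> transports_in C s p. f l)
       + (\<Sum>m \<in> technologies_gen C s p. tec_yield C m p * \<xi> m)
     = (\<Sum>j \<in> consumers_at C s p. d j) + (\<Sum>l \<in> transports_out C s p. f l)
       + (\<Sum>m \<in> technologies_con C s p. tec_yield C m p * \<xi> m))"

definition primal_feasible ::
  "('n, 't, 'p, 'g, 'd, 'l, 'm) supply_chain \<Rightarrow> ('g, 'd, 'l, 'm) allocation \<Rightarrow> bool" where
  "primal_feasible C = (\<lambda>(g, d, f, \<xi>).
     clearing C (g, d, f, \<xi>) \<and>
     (\<forall>i \<in> suppliers C. 0 \<le> g i \<and> g i \<le> sup_cap C i) \<and>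
     (\<forall>j \<in> consumers C. 0 \<le> d j \<and> d j \<le> con_cap C j) \<and>
     (\<forall>l \<in> transports C. 0 \<le> f l \<and> f l \<le> tra_cap C l) \<and>
     (\<forall>m \<in> technologies C. 0 \<le> \<xi> m \<and> \<xi> m \<le> tec_cap C m))"

definition primal_objective ::
  "('n, 't, 'p, 'g, 'd, 'l, 'm) supply_chain \<Rightarrow> ('g, 'd, 'l, 'm) allocation \<Rightarrow> real" where
  "primal_objective C = (\<lambda>(g, d, f, \<xi>).
     (\<Sum>j \<in> consumers C. con_bid C j * d j) - (\<Sum>i \<in> suppliers C. sup_bid C i * g i)
     - (\<Sum>l \<in> transports C. tra_bid C l * f l) - (\<Sum>m \<in> technologies C. tec_bid C m * \<xi> m))"

definition primal_optimal where
  "primal_optimal C x = is_arg_max (primal_objective C) (primal_feasible C) x"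

definition sup_price :: "('n, 't, 'p, 'g, 'd, 'l, 'm) supply_chain \<Rightarrow> ('n, 't, 'p) prices \<Rightarrow> 'g \<Rightarrow> real" where
  "sup_price C \<pi> i = \<pi> (sup_node C i) (sup_prod C i)"

definition con_price :: "('n, 't, 'p, 'g, 'd, 'l, 'm) supply_chain \<Rightarrow> ('n, 't, 'p) prices \<Rightarrow> 'd \<Rightarrow> real" where
  "con_price C \<pi> j = \<pi> (con_node C j) (con_prod C j)"

definition tra_price :: "('n, 't, 'p, 'g, 'd, 'l, 'm) supply_chain \<Rightarrow> ('n, 't, 'p) prices \<Rightarrow> 'l \<Rightarrow> real" where
  "tra_price C \<pi> l = \<pi> (tra_recv C l) (tra_prod C l) - \<pi> (tra_base C l) (tra_prod C l)"

definition tec_price :: "('n, 't, 'p, 'g, 'd, 'l, 'm) supply_chain \<Rightarrow> ('n, 't, 'p) prices \<Rightarrow> 'm \<Rightarrow> real" where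
  "tec_price C \<pi> m =
     (\<Sum>p \<in> tec_gen C m. tec_yield C m p * \<pi> (tec_node C m) p)
     - (\<Sum>p \<in> tec_con C m. tec_yield C m p * \<pi> (tec_node C m) p)"

(* The capacity multipliers form a tuple of the same shape as an allocation, one per player. *)
definition dual_feasible ::
  "('n, 't, 'p, 'g, 'd, 'l, 'm) supply_chain \<Rightarrow>
   ('n, 't, 'p) prices \<times> ('g, 'd, 'l, 'm) allocation \<Rightarrow> bool" where
  "dual_feasible C = (\<lambda>(\<pi>, lam_g, lam_d, lam_l, lam_m).
     (\<forall>i \<in> suppliers C. 0 \<le> lam_g i \<and> sup_price C \<pi> i - lam_g i \<le> sup_bid C i) \<and>
     (\<forall>j \<in> consumers C. 0 \<le> lam_d j \<and> con_price C \<pi> j + lam_d j \<ge> con_bid C j) \<and>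
     (\<forall>l \<in> transports C. 0 \<le> lam_l l \<and> tra_price C \<pi> l - lam_l l \<le> tra_bid C l) \<and>
     (\<forall>m \<in> technologies C. 0 \<le> lam_m m \<and> tec_price C \<pi> m - lam_m m \<le> tec_bid C m))"

definition dual_objective ::
  "('n, 't, 'p, 'g, 'd, 'l, 'm) supply_chain \<Rightarrow>
   ('n, 't, 'p) prices \<times> ('g, 'd, 'l, 'm) allocation \<Rightarrow> real" where
  "dual_objective C = (\<lambda>(\<pi>, lam_g, lam_d, lam_l, lam_m).
     (\<Sum>i \<in> suppliers C. sup_cap C i * lam_g i) + (\<Sum>j \<in> consumers C. con_cap C j * lam_d j)
     + (\<Sum>l \<in> transports C. tra_cap C l * lam_l l) + (\<Sum>m \<in> technologies C. tec_cap C m * lam_m m))"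

definition dual_optimal where
  "dual_optimal C y = is_arg_min (dual_objective C) (dual_feasible C) y"

definition sup_profit where
  "sup_profit C \<pi> i x = (sup_price C \<pi> i - sup_bid C i) * x"

definition con_profit where
  "con_profit C \<pi> j x = (con_bid C j - con_price C \<pi> j) * x"

definition tra_profit where
  "tra_profit C \<pi> l x = (tra_price C \<pi> l - tra_bid C l) * x"

definition tec_profit where
  "tec_profit C \<pi> m x = (tec_price C \<pi> m - tec_bid C m) * x"

definition competitive_equilibrium ::
  "('n, 't, 'p, 'g, 'd, 'l, 'm) supply_chain \<Rightarrow>
   ('n, 't, 'p) prices \<Rightarrow> ('g, 'd, 'l, 'm) allocation \<Rightarrow> bool" where
  "competitive_equilibrium C \<pi> = (\<lambda>(g, d, f, \<xi>).
     (\<forall>i \<in> suppliers C. is_arg_max (sup_profit C \<pi> i) (\<lambda>x. 0 \<le> x \<and> x \<le> sup_cap C i) (g i)) \<and>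
     (\<forall>j \<in> consumers C. is_arg_max (con_profit C \<pi> j) (\<lambda>x. 0 \<le> x \<and> x \<le> con_cap C j) (d j)) \<and>
     (\<forall>l \<in> transports C. is_arg_max (tra_profit C \<pi> l) (\<lambda>x. 0 \<le> x \<and> x \<le> tra_cap C l) (f l)) \<and>
     (\<forall>m \<in> technologies C. is_arg_max (tec_profit C \<pi> m) (\<lambda>x. 0 \<le> x \<and> x \<le> tec_cap C m) (\<xi> m)) \<and>
     clearing C (g, d, f, \<xi>))"

end

theory Submission
  imports Defs
begin

text \<open>
  Pricing the clearing constraints with \<open>\<pi>\<close> turns the primal objective into the Lagrangian. For
  every price system and every allocation, the objective plus the value of the net supply equals
  the total profit of all players (\<open>total_profit_eq_Lagrangian\<close>); in particular total profit is
  the objective itself when the markets clear. A dual feasible multiplier \<open>\<lambda>\<close> of a player, times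
  its capacity, bounds the profit of that player, so the dual objective bounds the total profit
  player by player. If the two optimal values agree, each of these bounds must be tight at the
  optimal allocation, and a tight bound says that the player cannot earn more.

  What remains is strong duality: some dual feasible point costs no more than the primal optimum.
  The elimination of constraints, in the manner of Fourier and Motzkin, in
  \<open>exists_Lagrange_multipliers\<close> gives prices for which no corner
  of the box of capacities has a Lagrangian above the primal optimum. One of these corners is the
  collective best response to those very prices, where each player runs at capacity or not at
  all; its total profit is the dual objective when each multiplier is the positive part of
  the profit margin.
\<close>

section \<open>Lagrange multipliers for finitely many points of a convex set\<close>

lemma exists_real_between_finite_sets:
  fixes L U :: "real set"
  assumes "finite L" "finite U" and le: "\<And>l u. l \<in> L \<Longrightarrow> u \<in> U \<Longrightarrow> l \<le> u"
  shows "\<exists>t. (\<forall>l\<in>L. l \<le> t) \<and> (\<forall>u\<in>U. t \<le> u)"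
proof (cases "L = {}")
  case True
  show ?thesis
  proof (cases "U = {}")
    case False
    then show ?thesis using True assms by (intro exI[of _ "Min U"]) auto
  qed (use True in auto)
next
  case False
  then show ?thesis using assms by (intro exI[of _ "Max L"]) auto
qed

text \<open>
  Multipliers are found one constraint at a time. To eliminate the constraint \<open>r\<close>, every pair of
  points of \<open>T\<close> on opposite sides of the hyperplane \<open>\<rho> r = 0\<close> is replaced by the point where the
  connecting segment crosses it. Multipliers for the other constraints that serve these crossing
  points leave an interval of admissible values for the multiplier of \<open>r\<close>: a pair's crossing point
  says precisely that the lower bound from one end does not exceed the upper bound from the other.
  Finiteness of \<open>T\<close> makes the interval nonempty without a constraint qualification. The points
  are abstract, and convexity is asked only of the image of \<open>X\<close> under \<open>\<omega>\<close> and \<open>\<rho>\<close>, so that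
  tuples of functions can serve as points.
\<close>

lemma exists_Lagrange_multipliers:
  fixes \<rho> :: "'r \<Rightarrow> 'x \<Rightarrow> real" and \<omega> :: "'x \<Rightarrow> real"
  assumes "finite R" "finite T" "T \<subseteq> X"
    and "\<And>x y a. x \<in> X \<Longrightarrow> y \<in> X \<Longrightarrow> 0 \<le> a \<Longrightarrow> a \<le> 1 \<Longrightarrow>
      \<exists>z\<in>X. \<omega> z = (1 - a) * \<omega> x + a * \<omega> y \<and> (\<forall>r\<in>R. \<rho> r z = (1 - a) * \<rho> r x + a * \<rho> r y)"
    and "\<And>x. x \<in> X \<Longrightarrow> \<forall>r\<in>R. \<rho> r x = 0 \<Longrightarrow> \<omega> x \<le> B"
  shows "\<exists>\<pi>. \<forall>x\<in>T. \<omega> x + (\<Sum>r\<in>R. \<pi> r * \<rho> r x) \<le> B"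
  using assms
proof (induction R arbitrary: T X rule: finite_induct)
  case empty
  then show ?case by auto
next
  case (insert r R)
  note mix = insert.prems(3)
  define P where "P = {x\<in>T. 0 < \<rho> r x}"
  define N where "N = {x\<in>T. \<rho> r x < 0}"
  define a where "a x y = \<rho> r x / (\<rho> r x - \<rho> r y)" for x y
  have "\<forall>q\<in>P \<times> N. \<exists>z. z \<in> X \<and>
      \<omega> z = (1 - a (fst q) (snd q)) * \<omega> (fst q) + a (fst q) (snd q) * \<omega> (snd q) \<and>
      (\<forall>s\<in>insert r R. \<rho> s z = (1 - a (fst q) (snd q)) * \<rho> s (fst q) + a (fst q) (snd q) * \<rho> s (snd q))"
  proof
    fix q assume "q \<in> P \<times> N"
    then have "fst q \<in> X" "snd q \<in> X" "0 < \<rho> r (fst q)" "\<rho> r (snd q) < 0"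
      using insert.prems(2) by (auto simp: P_def N_def)
    then show "\<exists>z. z \<in> X \<and>
      \<omega> z = (1 - a (fst q) (snd q)) * \<omega> (fst q) + a (fst q) (snd q) * \<omega> (snd q) \<and>
      (\<forall>s\<in>insert r R. \<rho> s z = (1 - a (fst q) (snd q)) * \<rho> s (fst q) + a (fst q) (snd q) * \<rho> s (snd q))"
      using mix[of "fst q" "snd q" "a (fst q) (snd q)"] by (auto simp: a_def)
  qed
  from bchoice[OF this] obtain z where z: "\<And>x y. x \<in> P \<Longrightarrow> y \<in> N \<Longrightarrow> z (x, y) \<in> X \<and>
      \<omega> (z (x, y)) = (1 - a x y) * \<omega> x + a x y * \<omega> y \<and>
      (\<forall>s\<in>insert r R. \<rho> s (z (x, y)) = (1 - a x y) * \<rho> s x + a x y * \<rho> s y)"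
    by fastforce
  have z_zero: "\<rho> r (z (x, y)) = 0" if "x \<in> P" "y \<in> N" for x y
  proof -
    have "\<rho> r x - \<rho> r y > 0" using that by (auto simp: P_def N_def)
    then show ?thesis using z[OF that] by (simp add: a_def field_simps)
  qed
  define X0 where "X0 = {x\<in>X. \<rho> r x = 0}"
  define T0 where "T0 = {x\<in>T. \<rho> r x = 0} \<union> z ` (P \<times> N)"
  have "\<exists>\<pi>. \<forall>x\<in>T0. \<omega> x + (\<Sum>s\<in>R. \<pi> s * \<rho> s x) \<le> B"
  proof (rule insert.IH)
    show "finite T0" using insert.prems(1) by (auto simp: T0_def P_def N_def)
    show "T0 \<subseteq> X0" using insert.prems(2) z z_zero by (auto simp: T0_def X0_def)
    show "\<exists>w\<in>X0. \<omega> w = (1 - b) * \<omega> x + b * \<omega> y \<and> (\<forall>s\<in>R. \<rho> s w = (1 - b) * \<rho> s x + b * \<rho> s y)"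
      if "x \<in> X0" "y \<in> X0" "0 \<le> b" "b \<le> 1" for x y b
      using mix[of x y b] that by (fastforce simp: X0_def)
    show "\<omega> x \<le> B" if "x \<in> X0" "\<forall>s\<in>R. \<rho> s x = 0" for x
      using insert.prems(4) that by (auto simp: X0_def)
  qed
  then obtain \<pi> where \<pi>: "\<And>x. x \<in> T0 \<Longrightarrow> \<omega> x + (\<Sum>s\<in>R. \<pi> s * \<rho> s x) \<le> B" by auto
  define h where "h x = \<omega> x + (\<Sum>s\<in>R. \<pi> s * \<rho> s x)" for x
  have cross: "(B - h y) / \<rho> r y \<le> (B - h x) / \<rho> r x" if x: "x \<in> P" and y: "y \<in> N" for x y
  proof -
    have pos: "0 < \<rho> r x" "\<rho> r y < 0" using that by (auto simp: P_def N_def)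
    have at_z: "\<rho> s (z (x, y)) = (1 - a x y) * \<rho> s x + a x y * \<rho> s y" if "s \<in> R" for s
      using z[OF x y] that by blast
    have "(\<Sum>s\<in>R. \<pi> s * \<rho> s (z (x, y))) = (\<Sum>s\<in>R. (1 - a x y) * (\<pi> s * \<rho> s x) + a x y * (\<pi> s * \<rho> s y))"
      by (intro sum.cong refl) (simp only: at_z, simp add: algebra_simps)
    also have "\<dots> = (1 - a x y) * (\<Sum>s\<in>R. \<pi> s * \<rho> s x) + a x y * (\<Sum>s\<in>R. \<pi> s * \<rho> s y)"
      by (simp add: sum.distrib sum_distrib_left)
    finally have sum_at_z: "(\<Sum>s\<in>R. \<pi> s * \<rho> s (z (x, y))) =
      (1 - a x y) * (\<Sum>s\<in>R. \<pi> s * \<rho> s x) + a x y * (\<Sum>s\<in>R. \<pi> s * \<rho> s y)" .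
    have "\<omega> (z (x, y)) = (1 - a x y) * \<omega> x + a x y * \<omega> y"
      using z[OF x y] by blast
    then have "h (z (x, y)) = (1 - a x y) * h x + a x y * h y"
      unfolding h_def sum_at_z by (simp only: distrib_left)
    moreover have "h (z (x, y)) \<le> B" using \<pi> that by (auto simp: h_def T0_def)
    ultimately have "(1 - a x y) * h x + a x y * h y \<le> B" by simp
    moreover have "1 - a x y = - \<rho> r y / (\<rho> r x - \<rho> r y)" using pos by (simp add: a_def field_simps)
    ultimately have "(- \<rho> r y * h x + \<rho> r x * h y) / (\<rho> r x - \<rho> r y) \<le> B"
      by (simp add: a_def add_divide_distrib diff_divide_distrib)
    then have "- \<rho> r y * h x + \<rho> r x * h y \<le> B * (\<rho> r x - \<rho> r y)"
      using pos by (simp add: pos_divide_le_eq)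
    then have "\<rho> r y * (B - h x) \<le> \<rho> r x * (B - h y)" by (simp add: algebra_simps)
    then show ?thesis using pos by (simp add: field_simps)
  qed
  have "\<exists>t. (\<forall>l\<in>(\<lambda>y. (B - h y) / \<rho> r y) ` N. l \<le> t) \<and> (\<forall>u\<in>(\<lambda>x. (B - h x) / \<rho> r x) ` P. t \<le> u)"
    using insert.prems(1) cross
    by (intro exists_real_between_finite_sets) (auto simp: P_def N_def)
  then obtain t where t: "\<And>y. y \<in> N \<Longrightarrow> (B - h y) / \<rho> r y \<le> t"
      "\<And>x. x \<in> P \<Longrightarrow> t \<le> (B - h x) / \<rho> r x"
    by auto
  have bound: "h x + t * \<rho> r x \<le> B" if "x \<in> T" for x
  proof (rule linorder_cases[of "\<rho> r x" 0])
    assume "\<rho> r x < 0"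
    then show ?thesis using t(1)[of x] that by (simp add: N_def field_simps)
  next
    assume "\<rho> r x = 0"
    then show ?thesis using \<pi>[of x] that by (simp add: T0_def h_def)
  next
    assume "\<rho> r x > 0"
    then show ?thesis using t(2)[of x] that by (simp add: P_def field_simps)
  qed
  have "(\<Sum>s\<in>R. (\<pi>(r := t)) s * \<rho> s x) = (\<Sum>s\<in>R. \<pi> s * \<rho> s x)" for x
    using insert.hyps(2) by (intro sum.cong) auto
  then have "\<forall>x\<in>T. \<omega> x + (\<Sum>s\<in>insert r R. (\<pi>(r := t)) s * \<rho> s x) \<le> B"
    using bound insert.hyps by (simp add: h_def algebra_simps)
  then show ?case by blast
qed

section \<open>The Lagrangian is the total profit\<close>

definition net_supply ::
  "('n, 't, 'p, 'g, 'd, 'l, 'm) supply_chain \<Rightarrow> ('n, 't) st_node \<times> 'p \<Rightarrow> ('g, 'd, 'l, 'm) allocation \<Rightarrow> real" where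
  "net_supply C = (\<lambda>(s, p) (g, d, f, \<xi>).
     (\<Sum>i \<in> suppliers_at C s p. g i) + (\<Sum>l \<in> transports_in C s p. f l)
       + (\<Sum>m \<in> technologies_gen C s p. tec_yield C m p * \<xi> m)
     - ((\<Sum>j \<in> consumers_at C s p. d j) + (\<Sum>l \<in> transports_out C s p. f l)
       + (\<Sum>m \<in> technologies_con C s p. tec_yield C m p * \<xi> m)))"

definition total_profit ::
  "('n, 't, 'p, 'g, 'd, 'l, 'm) supply_chain \<Rightarrow> ('n, 't, 'p) prices \<Rightarrow> ('g, 'd, 'l, 'm) allocation \<Rightarrow> real" where
  "total_profit C \<pi> = (\<lambda>(g, d, f, \<xi>).
     (\<Sum>i \<in> suppliers C. sup_profit C \<pi> i (g i)) + (\<Sum>j \<in> consumers C. con_profit C \<pi> j (d j))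
     + (\<Sum>l \<in> transports C. tra_profit C \<pi> l (f l)) + (\<Sum>m \<in> technologies C. tec_profit C \<pi> m (\<xi> m)))"

definition capacity_box ::
  "('n, 't, 'p, 'g, 'd, 'l, 'm) supply_chain \<Rightarrow> ('g, 'd, 'l, 'm) allocation set" where
  "capacity_box C = {(g, d, f, \<xi>).
     (\<forall>i \<in> suppliers C. 0 \<le> g i \<and> g i \<le> sup_cap C i) \<and>
     (\<forall>j \<in> consumers C. 0 \<le> d j \<and> d j \<le> con_cap C j) \<and>
     (\<forall>l \<in> transports C. 0 \<le> f l \<and> f l \<le> tra_cap C l) \<and>
     (\<forall>m \<in> technologies C. 0 \<le> \<xi> m \<and> \<xi> m \<le> tec_cap C m)}"

lemma clearing_iff_net_supply:
  "clearing C x \<longleftrightarrow> (\<forall>r \<in> st_nodes C \<times> products C. net_supply C r x = 0)"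
  by (auto simp: clearing_def net_supply_def)

lemma primal_feasible_iff:
  "primal_feasible C x \<longleftrightarrow>
     x \<in> capacity_box C \<and> (\<forall>r \<in> st_nodes C \<times> products C. net_supply C r x = 0)"
  unfolding clearing_iff_net_supply[symmetric]
  by (cases x) (auto simp: primal_feasible_def capacity_box_def)

text \<open>
  This exchange of summations carries a constraint, indexed by markets, over to profits, indexed by
  players. It serves both sides of every kind of player: a technology has one of its product sets
  as \<open>Q i\<close> and its yields as weights, any other player a singleton and weight one.
\<close>

lemma sum_by_market_eq_sum_by_player:
  fixes x :: "'i \<Rightarrow> real"
  assumes "finite A" "finite S" "finite P"
    and "\<And>i. i \<in> A \<Longrightarrow> n i \<in> S \<and> Q i \<subseteq> P"
  shows "(\<Sum>(s, p) \<in> S \<times> P. \<pi> s p * (\<Sum>i \<in> {i \<in> A. n i = s \<and> p \<in> Q i}. w i p * x i))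
    = (\<Sum>i\<in>A. (\<Sum>p\<in>Q i. w i p * \<pi> (n i) p) * x i)"
proof -
  have "(\<Sum>(s, p) \<in> S \<times> P. \<pi> s p * (\<Sum>i \<in> {i \<in> A. n i = s \<and> p \<in> Q i}. w i p * x i))
      = (\<Sum>(s, p) \<in> S \<times> P. \<Sum>i\<in>A. if n i = s \<and> p \<in> Q i then \<pi> s p * (w i p * x i) else 0)"
    using assms(1)
    by (intro sum.cong) (auto simp: sum_distrib_left sum.inter_filter[symmetric] intro!: sum.cong)
  also have "\<dots> = (\<Sum>i\<in>A. \<Sum>(s, p) \<in> S \<times> P. if n i = s \<and> p \<in> Q i then \<pi> s p * (w i p * x i) else 0)"
    unfolding case_prod_unfold by (rule sum.swap)
  also have "\<dots> = (\<Sum>i\<in>A. (\<Sum>p\<in>Q i. w i p * \<pi> (n i) p) * x i)"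
  proof (rule sum.cong[OF refl])
    fix i assume i: "i \<in> A"
    have "(\<Sum>(s, p) \<in> S \<times> P. if n i = s \<and> p \<in> Q i then \<pi> s p * (w i p * x i) else 0)
        = (\<Sum>(s, p) \<in> {n i} \<times> Q i. \<pi> s p * (w i p * x i))"
      using assms i by (intro sum.mono_neutral_cong_right) (auto split: if_splits)
    also have "\<dots> = (\<Sum>p\<in>Q i. w i p * \<pi> (n i) p) * x i"
      by (simp add: sum.cartesian_product[symmetric] sum_distrib_left sum_distrib_right ac_simps)
    finally show "(\<Sum>(s, p) \<in> S \<times> P. if n i = s \<and> p \<in> Q i then \<pi> s p * (w i p * x i) else 0)
        = (\<Sum>p\<in>Q i. w i p * \<pi> (n i) p) * x i" .
  qed
  finally show ?thesis .
qed

context sc_st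
begin

lemma finite_st_nodes: "finite (st_nodes C)"
  by (simp add: st_nodes_def finite_spatial_nodes finite_times)

lemma total_profit_eq_Lagrangian:
  "total_profit C \<pi> x =
     primal_objective C x + (\<Sum>(s, p) \<in> st_nodes C \<times> products C. \<pi> s p * net_supply C (s, p) x)"
proof -
  obtain g d f \<xi> where x: "x = (g, d, f, \<xi>)" by (cases x)
  let ?SP = "st_nodes C \<times> products C"
  note by_player = sum_by_market_eq_sum_by_player[OF _ finite_st_nodes finite_products]
  have sup: "(\<Sum>(s, p)\<in>?SP. \<pi> s p * (\<Sum>i\<in>suppliers_at C s p. g i)) = (\<Sum>i\<in>suppliers C. sup_price C \<pi> i * g i)"
    using by_player[OF finite_suppliers, of "sup_node C" "\<lambda>i. {sup_prod C i}" \<pi> "\<lambda>_ _. 1" g] supplier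
    by (simp add: suppliers_at_def sup_price_def eq_commute[of _ "sup_prod C _"])
  have con: "(\<Sum>(s, p)\<in>?SP. \<pi> s p * (\<Sum>j\<in>consumers_at C s p. d j)) = (\<Sum>j\<in>consumers C. con_price C \<pi> j * d j)"
    using by_player[OF finite_consumers, of "con_node C" "\<lambda>i. {con_prod C i}" \<pi> "\<lambda>_ _. 1" d] consumer
    by (simp add: consumers_at_def con_price_def eq_commute[of _ "con_prod C _"])
  have tin: "(\<Sum>(s, p)\<in>?SP. \<pi> s p * (\<Sum>l\<in>transports_in C s p. f l))
      = (\<Sum>l\<in>transports C. \<pi> (tra_recv C l) (tra_prod C l) * f l)"
    using by_player[OF finite_transports, of "tra_recv C" "\<lambda>i. {tra_prod C i}" \<pi> "\<lambda>_ _. 1" f] transport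
    by (simp add: transports_in_def eq_commute[of _ "tra_prod C _"])
  have tout: "(\<Sum>(s, p)\<in>?SP. \<pi> s p * (\<Sum>l\<in>transports_out C s p. f l))
      = (\<Sum>l\<in>transports C. \<pi> (tra_base C l) (tra_prod C l) * f l)"
    using by_player[OF finite_transports, of "tra_base C" "\<lambda>i. {tra_prod C i}" \<pi> "\<lambda>_ _. 1" f] transport
    by (simp add: transports_out_def eq_commute[of _ "tra_prod C _"])
  have gen: "(\<Sum>(s, p)\<in>?SP. \<pi> s p * (\<Sum>m\<in>technologies_gen C s p. tec_yield C m p * \<xi> m))
      = (\<Sum>m\<in>technologies C. (\<Sum>p\<in>tec_gen C m. tec_yield C m p * \<pi> (tec_node C m) p) * \<xi> m)"
    unfolding technologies_gen_def using technology by (intro by_player[OF finite_technologies]) auto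
  have cns: "(\<Sum>(s, p)\<in>?SP. \<pi> s p * (\<Sum>m\<in>technologies_con C s p. tec_yield C m p * \<xi> m))
      = (\<Sum>m\<in>technologies C. (\<Sum>p\<in>tec_con C m. tec_yield C m p * \<pi> (tec_node C m) p) * \<xi> m)"
    unfolding technologies_con_def using technology by (intro by_player[OF finite_technologies]) auto
  have "(\<Sum>(s, p)\<in>?SP. \<pi> s p * net_supply C (s, p) x) =
      (\<Sum>(s, p)\<in>?SP. \<pi> s p * (\<Sum>i\<in>suppliers_at C s p. g i))
      + (\<Sum>(s, p)\<in>?SP. \<pi> s p * (\<Sum>l\<in>transports_in C s p. f l))
      + (\<Sum>(s, p)\<in>?SP. \<pi> s p * (\<Sum>m\<in>technologies_gen C s p. tec_yield C m p * \<xi> m))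
      - (\<Sum>(s, p)\<in>?SP. \<pi> s p * (\<Sum>j\<in>consumers_at C s p. d j))
      - (\<Sum>(s, p)\<in>?SP. \<pi> s p * (\<Sum>l\<in>transports_out C s p. f l))
      - (\<Sum>(s, p)\<in>?SP. \<pi> s p * (\<Sum>m\<in>technologies_con C s p. tec_yield C m p * \<xi> m))"
    unfolding sum.distrib[symmetric] sum_subtractf[symmetric]
    by (intro sum.cong) (auto simp: x net_supply_def algebra_simps)
  then show ?thesis
    unfolding sup con tin tout gen cns
    by (simp add: x total_profit_def primal_objective_def sup_profit_def con_profit_def tra_profit_def
        tec_profit_def tra_price_def tec_price_def algebra_simps sum.distrib sum_subtractf)
qed

section \<open>Strong duality\<close>

lemma capacity_box_mix:
  assumes "x \<in> capacity_box C" "y \<in> capacity_box C" "0 \<le> a" "a \<le> 1"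
  shows "\<exists>z \<in> capacity_box C.
    primal_objective C z = (1 - a) * primal_objective C x + a * primal_objective C y \<and>
    (\<forall>r \<in> st_nodes C \<times> products C.
       net_supply C r z = (1 - a) * net_supply C r x + a * net_supply C r y)"
proof -
  obtain g d f \<xi> where x: "x = (g, d, f, \<xi>)" by (cases x)
  obtain g' d' f' \<xi>' where y: "y = (g', d', f', \<xi>')" by (cases y)
  define mix :: "real \<Rightarrow> real \<Rightarrow> real" where "mix u v = (1 - a) * u + a * v" for u v
  define z where "z = (\<lambda>i. mix (g i) (g' i), \<lambda>j. mix (d j) (d' j), \<lambda>l. mix (f l) (f' l), \<lambda>m. mix (\<xi> m) (\<xi>' m))"
  have mix_le: "mix u v \<le> c" if "u \<le> c" "v \<le> c" for u v c
    unfolding mix_def using that assms(3,4) by (intro convex_bound_le) auto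
  have mix_ge: "0 \<le> mix u v" if "0 \<le> u" "0 \<le> v" for u v
    unfolding mix_def using that assms(3,4) by simp
  have mult_mix: "c * mix u v = mix (c * u) (c * v)" for c u v
    by (simp add: mix_def algebra_simps)
  have sum_mix: "(\<Sum>i\<in>A. mix (p i) (q i)) = mix (sum p A) (sum q A)" for A :: "'z set" and p q
    by (simp add: mix_def sum.distrib sum_distrib_left)
  have "z \<in> capacity_box C"
    using assms(1,2) mix_le mix_ge by (auto simp: capacity_box_def x y z_def)
  moreover have "primal_objective C z = mix (primal_objective C x) (primal_objective C y)"
    unfolding primal_objective_def x y z_def prod.case mult_mix sum_mix
    by (simp add: mix_def algebra_simps)
  moreover have "net_supply C r z = mix (net_supply C r x) (net_supply C r y)" for r
    unfolding net_supply_def x y z_def case_prod_unfold fst_conv snd_conv mult_mix sum_mix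
    by (simp add: mix_def algebra_simps)
  ultimately show ?thesis unfolding mix_def by blast
qed

text \<open>
  The multipliers must be found before the best response to them is known, so all corners of the
  capacity box are fed into the multiplier lemma at once; they are finitely many when functions
  are pinned outside the sets of players.
\<close>

lemma exists_dual_feasible_le_primal_optimum:
  assumes opt: "primal_optimal C x"
  shows "\<exists>y. dual_feasible C y \<and> dual_objective C y \<le> primal_objective C x"
proof -
  define corners where "corners =
    (\<Pi>\<^sub>E i\<in>suppliers C. {0, sup_cap C i}) \<times> (\<Pi>\<^sub>E j\<in>consumers C. {0, con_cap C j}) \<times>
    (\<Pi>\<^sub>E l\<in>transports C. {0, tra_cap C l}) \<times> (\<Pi>\<^sub>E m\<in>technologies C. {0, tec_cap C m})"
  have "\<exists>\<pi>. \<forall>v\<in>corners. primal_objective C v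
      + (\<Sum>r\<in>st_nodes C \<times> products C. \<pi> r * net_supply C r v) \<le> primal_objective C x"
  proof (rule exists_Lagrange_multipliers)
    show "finite (st_nodes C \<times> products C)" by (simp add: finite_st_nodes finite_products)
    show "finite corners"
      by (auto simp: corners_def finite_suppliers finite_consumers finite_transports
          finite_technologies intro!: finite_PiE finite_cartesian_product)
    show "corners \<subseteq> capacity_box C"
      using supplier consumer transport technology
      by (fastforce simp: corners_def capacity_box_def PiE_iff)
    show "primal_objective C v \<le> primal_objective C x"
      if "v \<in> capacity_box C" "\<forall>r\<in>st_nodes C \<times> products C. net_supply C r v = 0" for v
      using opt that primal_feasible_iff[of C v]
      by (simp add: primal_optimal_def is_arg_max_linorder del: split_paired_All)
  qed (rule capacity_box_mix)
  then obtain \<pi>' where \<pi>': "\<And>v. v \<in> corners \<Longrightarrow> primal_objective C v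
      + (\<Sum>r\<in>st_nodes C \<times> products C. \<pi>' r * net_supply C r v) \<le> primal_objective C x"
    by blast
  define \<pi> where "\<pi> s p = \<pi>' (s, p)" for s p
  have profit_le: "total_profit C \<pi> v \<le> primal_objective C x" if "v \<in> corners" for v
    using \<pi>'[OF that] by (simp add: total_profit_eq_Lagrangian \<pi>_def case_prod_unfold)
  define run :: "real \<Rightarrow> real \<Rightarrow> real" where "run c u = (if 0 < c then u else 0)" for c u
  define v where "v =
    (restrict (\<lambda>i. run (sup_price C \<pi> i - sup_bid C i) (sup_cap C i)) (suppliers C),
     restrict (\<lambda>j. run (con_bid C j - con_price C \<pi> j) (con_cap C j)) (consumers C),
     restrict (\<lambda>l. run (tra_price C \<pi> l - tra_bid C l) (tra_cap C l)) (transports C),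
     restrict (\<lambda>m. run (tec_price C \<pi> m - tec_bid C m) (tec_cap C m)) (technologies C))"
  define y where "y = (\<pi>, \<lambda>i. max 0 (sup_price C \<pi> i - sup_bid C i), \<lambda>j. max 0 (con_bid C j - con_price C \<pi> j),
     \<lambda>l. max 0 (tra_price C \<pi> l - tra_bid C l), \<lambda>m. max 0 (tec_price C \<pi> m - tec_bid C m))"
  have "v \<in> corners" by (auto simp: corners_def v_def run_def)
  moreover have "dual_feasible C y" by (auto simp: dual_feasible_def y_def)
  moreover have run: "c * run c u = u * max 0 c" for c u by (auto simp: run_def)
  have "total_profit C \<pi> v = dual_objective C y"
    by (simp add: total_profit_def dual_objective_def v_def y_def sup_profit_def con_profit_def
        tra_profit_def tec_profit_def run)
  ultimately show ?thesis using profit_le by metis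
qed

end

section \<open>Tight dual bounds are equilibria\<close>

lemma margin_times_flow_le:
  fixes c u lam x :: real
  assumes "0 \<le> lam" "c \<le> lam" "0 \<le> x" "x \<le> u"
  shows "c * x \<le> u * lam"
  using mult_mono[OF assms(2,4,1,3)] by (simp add: mult.commute)

theorem theorem3:
  fixes C :: "('n, 't :: linorder, 'p, 'g, 'd, 'l, 'm) supply_chain"
    and g :: "'g \<Rightarrow> real" and d :: "'d \<Rightarrow> real" and f :: "'l \<Rightarrow> real" and \<xi> :: "'m \<Rightarrow> real"
    and \<pi> :: "('n, 't, 'p) prices"
    and lam_g :: "'g \<Rightarrow> real" and lam_d :: "'d \<Rightarrow> real" and lam_l :: "'l \<Rightarrow> real" and lam_m :: "'m \<Rightarrow> real"
  assumes "sc_st C"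
    and "primal_optimal C (g, d, f, \<xi>)"
    and "dual_optimal C (\<pi>, lam_g, lam_d, lam_l, lam_m)"
  shows "competitive_equilibrium C \<pi> (g, d, f, \<xi>)"
proof -
  interpret sc_st C by fact
  let ?x = "(g, d, f, \<xi>)" and ?y = "(\<pi>, lam_g, lam_d, lam_l, lam_m)"
  have feas: "primal_feasible C ?x" using assms(2) by (simp add: primal_optimal_def is_arg_max_linorder)
  have dual: "dual_feasible C ?y" using assms(3) by (simp add: dual_optimal_def is_arg_min_linorder)
  have "dual_objective C ?y \<le> primal_objective C ?x"
    using exists_dual_feasible_le_primal_optimum[OF assms(2)] assms(3)
    by (fastforce simp: dual_optimal_def is_arg_min_linorder)
  also have "primal_objective C ?x = total_profit C \<pi> ?x"
    unfolding total_profit_eq_Lagrangian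
    using feas by (auto simp: primal_feasible_iff intro!: sum.neutral)
  finally have no_gap: "dual_objective C ?y \<le> total_profit C \<pi> ?x" .
  have sup_le: "sup_profit C \<pi> i q \<le> sup_cap C i * lam_g i"
    if "i \<in> suppliers C" "0 \<le> q" "q \<le> sup_cap C i" for i q
    unfolding sup_profit_def using dual that by (intro margin_times_flow_le) (auto simp: dual_feasible_def)
  have con_le: "con_profit C \<pi> j q \<le> con_cap C j * lam_d j"
    if "j \<in> consumers C" "0 \<le> q" "q \<le> con_cap C j" for j q
    unfolding con_profit_def using dual that by (intro margin_times_flow_le) (auto simp: dual_feasible_def)
  have tra_le: "tra_profit C \<pi> l q \<le> tra_cap C l * lam_l l"
    if "l \<in> transports C" "0 \<le> q" "q \<le> tra_cap C l" for l q
    unfolding tra_profit_def using dual that by (intro margin_times_flow_le) (auto simp: dual_feasible_def)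
  have tec_le: "tec_profit C \<pi> m q \<le> tec_cap C m * lam_m m"
    if "m \<in> technologies C" "0 \<le> q" "q \<le> tec_cap C m" for m q
    unfolding tec_profit_def using dual that by (intro margin_times_flow_le) (auto simp: dual_feasible_def)
  have ranges: "\<forall>i \<in> suppliers C. 0 \<le> g i \<and> g i \<le> sup_cap C i"
      "\<forall>j \<in> consumers C. 0 \<le> d j \<and> d j \<le> con_cap C j"
      "\<forall>l \<in> transports C. 0 \<le> f l \<and> f l \<le> tra_cap C l"
      "\<forall>m \<in> technologies C. 0 \<le> \<xi> m \<and> \<xi> m \<le> tec_cap C m"
    and clear: "clearing C ?x"
    using feas by (auto simp: primal_feasible_def)
  have sums_le:
      "(\<Sum>i\<in>suppliers C. sup_profit C \<pi> i (g i)) \<le> (\<Sum>i\<in>suppliers C. sup_cap C i * lam_g i)"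
      "(\<Sum>j\<in>consumers C. con_profit C \<pi> j (d j)) \<le> (\<Sum>j\<in>consumers C. con_cap C j * lam_d j)"
      "(\<Sum>l\<in>transports C. tra_profit C \<pi> l (f l)) \<le> (\<Sum>l\<in>transports C. tra_cap C l * lam_l l)"
      "(\<Sum>m\<in>technologies C. tec_profit C \<pi> m (\<xi> m)) \<le> (\<Sum>m\<in>technologies C. tec_cap C m * lam_m m)"
    using ranges by (auto intro!: sum_mono sup_le con_le tra_le tec_le)
  have sums_eq:
      "(\<Sum>i\<in>suppliers C. sup_profit C \<pi> i (g i)) = (\<Sum>i\<in>suppliers C. sup_cap C i * lam_g i)"
      "(\<Sum>j\<in>consumers C. con_profit C \<pi> j (d j)) = (\<Sum>j\<in>consumers C. con_cap C j * lam_d j)"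
      "(\<Sum>l\<in>transports C. tra_profit C \<pi> l (f l)) = (\<Sum>l\<in>transports C. tra_cap C l * lam_l l)"
      "(\<Sum>m\<in>technologies C. tec_profit C \<pi> m (\<xi> m)) = (\<Sum>m\<in>technologies C. tec_cap C m * lam_m m)"
    using sums_le no_gap by (simp_all add: dual_objective_def total_profit_def)
  have tight:
      "\<And>i. i \<in> suppliers C \<Longrightarrow> sup_profit C \<pi> i (g i) = sup_cap C i * lam_g i"
      "\<And>j. j \<in> consumers C \<Longrightarrow> con_profit C \<pi> j (d j) = con_cap C j * lam_d j"
      "\<And>l. l \<in> transports C \<Longrightarrow> tra_profit C \<pi> l (f l) = tra_cap C l * lam_l l"
      "\<And>m. m \<in> technologies C \<Longrightarrow> tec_profit C \<pi> m (\<xi> m) = tec_cap C m * lam_m m"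
    using ranges finite_suppliers finite_consumers finite_transports finite_technologies
    by (auto intro!: sum_mono_inv[OF sums_eq(1)] sum_mono_inv[OF sums_eq(2)]
        sum_mono_inv[OF sums_eq(3)] sum_mono_inv[OF sums_eq(4)] sup_le con_le tra_le tec_le)
  show ?thesis
    using ranges clear
    by (auto simp: competitive_equilibrium_def is_arg_max_linorder tight intro: sup_le con_le tra_le tec_le)
qed

end
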